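(* Let $n\ge 2$ be an integer (odd or even). The $h^*$-vector of $Q_n$ satisfies $h^*_i=1$ for $0\le i\le n-1$ and $h^*_i=0$ otherwise.
   Context: Polytope $Q_n$: let $I$ be the $n\times n$ identity matrix and let $R$ be the $n\times n$ matrix, with rows and columns indexed by $0,\ldots,n-1$, whose entry at $(i,j)$ is $1$ if $j\equiv i+1\bmod n$ and $0$ otherwise. Then $Q_n\subset\mathbb{R}^{n^2}$ is the convex hull of the rows of the $2n\times n^2$ block matrix $$\begin{bmatrix} I & I & I & \cdots & I\\ I & R^1 & R^2 & \cdots & R^{n-1}\end{bmatrix}.$$ It is a lattice polytope with respect to $\mathbb{Z}^{n^2}$. For a lattice polytope $P\subset\mathbb{R}^N$ (vertices in $\mathbb{Z}^N$) of dimension $d$, the Ehrhart polynomial is $L_P(k)=|kP\cap\mathbb{Z}^N|$. Its generating function has the form $$\sum_{m\ge 0}L_P(m)t^m=\frac{h^*(t)}{(1-t)^{d+1}}$$ for a polynomial $h^*(t)=\sum_i h^*_i t^i$ of degree at most $d$ with non-negative integer coefficients; the $h^*$-vector of $P$ is the vector of coefficients of $h^*(t)$. *)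

theory Defs
  imports
    "HOL-Analysis.Analysis"
    "HOL-Computational_Algebra.Computational_Algebra"
    "HOL-Number_Theory.Cong"
begin

no_notation fps_nth (infixl "$" 75)

(* The lattice is the standard one, i.e. the points all of whose coordinates are integers. *)
definition ehrhart :: "(real ^ 'm) set \<Rightarrow> nat \<Rightarrow> nat" where
  "ehrhart P k = card {x \<in> (\<lambda>v. real k *\<^sub>R v) ` P. \<forall>i. x $ i \<in> \<int>}"

(* Division is division of formal power series; the denominator has constant coefficient 1,
   so there is at most one such h.  For a lattice polytope it exists. *)
definition hstar_poly :: "(real ^ 'm) set \<Rightarrow> rat poly" where
  "hstar_poly P =
     (THE h. Abs_fps (\<lambda>m. of_nat (ehrhart P m)) =
             fps_of_poly h / (1 - fps_X) ^ (nat (aff_dim P) + 1))"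

(* Matrix power with respect to the matrix product: the operation (^) on the type
   real ^ 'n ^ 'n would be the entrywise power. *)
definition matrix_power :: "real ^ 'n ^ 'n \<Rightarrow> nat \<Rightarrow> real ^ 'n ^ 'n" where
  "matrix_power A k = ((\<lambda>B. A ** B) ^^ k) (mat 1)"

(* In what follows n = CARD('n), and idx :: 'n => nat is meant to be a bijection onto {0..<n};
   it labels the elements of the index type 'n by 0, ..., n - 1. *)

definition cyclic_shift :: "('n::finite \<Rightarrow> nat) \<Rightarrow> real ^ 'n ^ 'n" where
  "cyclic_shift idx =
     (\<chi> i j. if [idx j = idx i + 1] (mod CARD('n)) then 1 else 0)"

(* Rows Inl i form the upper block row, rows Inr i the lower one; column (k, j) is the
   j-th column of the k-th block column.  The block R^0 is the identity matrix. *)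
definition Q_matrix :: "('n::finite \<Rightarrow> nat) \<Rightarrow> real ^ ('n \<times> 'n) ^ ('n + 'n)" where
  "Q_matrix idx =
     (\<chi> r c. case c of (k, j) \<Rightarrow>
        (case r of
           Inl i \<Rightarrow> (mat 1 :: real ^ 'n ^ 'n) $ i $ j
         | Inr i \<Rightarrow> matrix_power (cyclic_shift idx) (idx k) $ i $ j))"

definition Q_polytope :: "('n::finite \<Rightarrow> nat) \<Rightarrow> (real ^ ('n \<times> 'n)) set" where
  "Q_polytope idx = convex hull (rows (Q_matrix idx))"

end

theory Submission
  imports Defs
begin

text \<open>
  Write \<open>u\<^sub>j\<close> and \<open>v\<^sub>l\<close> for the rows of the upper and the lower half of the matrix. Column
  \<open>(k, j)\<close> has a \<open>1\<close> in exactly two rows, namely \<open>u\<^sub>j\<close> and the \<open>v\<^sub>l\<close> with \<open>j \<equiv> l + k\<close>, and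
  every pair \<open>(j, l)\<close> belongs to exactly one column. Up to a permutation of coordinates,
  \<open>\<Sum>a\<^sub>j u\<^sub>j + \<Sum>b\<^sub>l v\<^sub>l\<close> is therefore the matrix with entries \<open>a\<^sub>j + b\<^sub>l\<close> (\<open>row_comb_nth\<close>). It
  determines the coefficients up to replacing \<open>a\<^sub>j\<close> by \<open>a\<^sub>j + t\<close> and \<open>b\<^sub>l\<close> by \<open>b\<^sub>l - t\<close>, that is, up
  to multiples of the single relation \<open>\<Sum>u\<^sub>j = \<Sum>v\<^sub>l\<close>. This relation is affine, so the \<open>2n\<close> rows
  span an affine space of dimension \<open>2n - 2\<close> (\<open>aff_dim_Q\<close>).

  If all \<open>a\<^sub>j + b\<^sub>l\<close> are integers, then the \<open>a\<^sub>j\<close> share one fractional part, which can be moved to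
  the \<open>b\<^sub>l\<close>. So the lattice points of the \<open>k\<close>-th dilate are the combinations whose coefficients are
  natural numbers with sum \<open>k\<close> (\<open>lattice_points_scaled_Q\<close>), and each of them has exactly one such
  representation with \<open>min a\<^sub>j = 0\<close>. Among the weak compositions of \<open>k\<close> into \<open>2n\<close> parts, those with
  all \<open>a\<^sub>j\<close> positive correspond to the weak compositions of \<open>k - n\<close> (\<open>ehrhart_Q\<close>). Weak
  compositions into \<open>2n\<close> parts have the generating function \<open>1 / (1 - X)\<^sup>2\<^sup>n\<close>, hence the Ehrhart
  series is
  \<open>(1 - X\<^sup>n) / (1 - X)\<^sup>2\<^sup>n = (1 + X + \<dots> + X\<^sup>n\<^sup>-\<^sup>1) / (1 - X)\<^sup>2\<^sup>n\<^sup>-\<^sup>1\<close>,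
  whose denominator is the one that belongs to dimension \<open>2n - 2\<close>.
\<close>

section \<open>Uniqueness of the numerator\<close>

text \<open>The denominator is a unit among the formal power series, so the numerator that
  the definite description asks for can be read off after clearing denominators.\<close>

lemma hstar_poly_eqI:
  assumes "Abs_fps (\<lambda>m. of_nat (ehrhart P m)) * (1 - fps_X) ^ (nat (aff_dim P) + 1)
             = fps_of_poly h"
  shows "hstar_poly P = h"
proof -
  define D :: "rat fps" where "D = (1 - fps_X) ^ (nat (aff_dim P) + 1)"
  define F :: "rat fps" where "F = Abs_fps (\<lambda>m. of_nat (ehrhart P m))"
  have D0: "fps_nth D 0 \<noteq> 0"
    by (simp add: D_def fps_nth_power_0)
  have "F = g / D \<longleftrightarrow> F * D = g" for g
  proof -
    have 1: "inverse D * D = 1" and 2: "D * inverse D = 1"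
      using inverse_mult_eq_1[OF D0] inverse_mult_eq_1'[OF D0] by blast+
    show ?thesis
    proof
      assume "F = g / D"
      then have "F * D = g * (inverse D * D)"
        by (simp only: fps_divide_unit[OF D0] mult.assoc)
      then show "F * D = g" by (simp only: 1 mult_1_right)
    next
      assume "F * D = g"
      then have "g / D = F * (D * inverse D)"
        by (simp only: fps_divide_unit[OF D0] mult.assoc[symmetric])
      then show "F = g / D" by (simp only: 2 mult_1_right)
    qed
  qed
  moreover have "F * D = fps_of_poly h"
    using assms by (simp only: F_def D_def)
  ultimately have "F = fps_of_poly g / D \<longleftrightarrow> g = h" for g
    by (metis fps_of_poly_eq_iff)
  then show ?thesis
    unfolding hstar_poly_def F_def[symmetric] D_def[symmetric] by (simp only: the_eq_trivial)
qed

section \<open>Counting weak compositions\<close>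

text \<open>Turning functions on a finite type into lists gives access to the formula for the
  coefficients of a power of a formal power series, which is a sum over \<open>natpermute\<close>.\<close>

lemma bij_betw_weak_compositions_natpermute:
  assumes "distinct xs" "set xs = (UNIV :: 'a::finite set)"
  shows "bij_betw (\<lambda>c. map c xs) {c :: 'a \<Rightarrow> nat. sum c UNIV = k} (natpermute k (length xs))"
proof (rule bij_betw_imageI)
  show "inj_on (\<lambda>c. map c xs) {c :: 'a \<Rightarrow> nat. sum c UNIV = k}"
    by (rule inj_onI, rule ext) (metis UNIV_I assms(2) map_eq_conv)
  have sum: "sum_list (map c xs) = sum c UNIV" for c :: "'a \<Rightarrow> nat"
    using assms by (simp add: sum_list_distinct_conv_sum_set)
  show "(\<lambda>c. map c xs) ` {c. sum c UNIV = k} = natpermute k (length xs)"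
  proof (intro equalityI subsetI)
    fix l assume l: "l \<in> natpermute k (length xs)"
    define c where "c = (\<lambda>i. the (map_of (zip xs l) i))"
    have "map c xs = l"
      using l assms(1) by (intro nth_equalityI) (auto simp: c_def natpermute_def map_of_zip_nth)
    with l sum[of c] show "l \<in> (\<lambda>c. map c xs) ` {c. sum c UNIV = k}"
      by (intro image_eqI[of _ _ c]) (auto simp: natpermute_def)
  qed (auto simp: natpermute_def sum)
qed

lemma finite_weak_compositions: "finite {c :: 'a::finite \<Rightarrow> nat. sum c UNIV = k}"
proof -
  obtain xs :: "'a list" where "set xs = UNIV" "distinct xs"
    using finite_distinct_list[OF finite, of UNIV] by blast
  then have bij: "bij_betw (\<lambda>c. map c xs) {c :: 'a \<Rightarrow> nat. sum c UNIV = k} (natpermute k (length xs))"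
    by (intro bij_betw_weak_compositions_natpermute)
  show ?thesis
    by (rule iffD2[OF bij_betw_finite[OF bij] natpermute_finite])
qed

text \<open>Choosing a weak composition means choosing one exponent in each of \<open>CARD('a)\<close> geometric
  series \<open>1 + X + X\<^sup>2 + \<dots>\<close>.\<close>

lemma fps_weak_compositions:
  "Abs_fps (\<lambda>k. of_nat (card {c :: 'a::finite \<Rightarrow> nat. sum c UNIV = k})) * (1 - fps_X) ^ CARD('a)
     = (1 :: 'b::field fps)"
proof -
  obtain xs :: "'a list" where xs: "set xs = UNIV" "distinct xs"
    using finite_distinct_list[OF finite, of UNIV] by blast
  then have len: "length xs = CARD('a)"
    by (metis distinct_card)
  have "Abs_fps (\<lambda>k. of_nat (card {c :: 'a \<Rightarrow> nat. sum c UNIV = k}))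
          = (Abs_fps (\<lambda>_. 1 :: 'b)) ^ CARD('a)"
  proof (rule fps_ext)
    fix k
    have "card {c :: 'a \<Rightarrow> nat. sum c UNIV = k} = card (natpermute k CARD('a))"
      using bij_betw_same_card[OF bij_betw_weak_compositions_natpermute[of xs k]] xs len by simp
    moreover obtain m where "CARD('a) = Suc m"
      using gr0_conv_Suc zero_less_card_finite by blast
    ultimately show "fps_nth (Abs_fps (\<lambda>k. of_nat (card {c :: 'a \<Rightarrow> nat. sum c UNIV = k}))) k
           = fps_nth ((Abs_fps (\<lambda>_. 1 :: 'b)) ^ CARD('a)) k"
      by (simp add: fps_power_nth del: power_Suc)
  qed
  moreover have "Abs_fps (\<lambda>_. 1 :: 'b) * (1 - fps_X) = 1"
    by (rule fps_ext) (auto simp: algebra_simps)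
  ultimately show ?thesis
    by (simp only: power_mult_distrib[symmetric] power_one)
qed

lemma sum_UNIV_Plus:
  fixes c :: "'a::finite + 'b::finite \<Rightarrow> 'c::comm_monoid_add"
  shows "sum c UNIV = (\<Sum>i\<in>UNIV. c (Inl i)) + (\<Sum>i\<in>UNIV. c (Inr i))"
  by (simp add: sum.Plus flip: UNIV_Plus_UNIV)

text \<open>Subtracting \<open>1\<close> from every part indexed by the left summand removes the positivity
  condition and lowers the total by \<open>CARD('a)\<close>.\<close>

lemma card_weak_compositions_Inl_positive:
  "card {c :: 'a::finite + 'b::finite \<Rightarrow> nat. sum c UNIV = k \<and> (\<forall>j. c (Inl j) > 0)}
     = (if k < CARD('a) then 0
        else card {c :: 'a + 'b \<Rightarrow> nat. sum c UNIV = k - CARD('a)})"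
proof (cases "k < CARD('a)")
  case True
  have "\<not> (sum c UNIV = k \<and> (\<forall>j. c (Inl j) > 0))" for c :: "'a + 'b \<Rightarrow> nat"
  proof
    assume c: "sum c UNIV = k \<and> (\<forall>j. c (Inl j) > 0)"
    have "CARD('a) = (\<Sum>j\<in>(UNIV :: 'a set). 1)" by simp
    also have "\<dots> \<le> (\<Sum>j\<in>UNIV. c (Inl j))"
      using c by (intro sum_mono) (simp add: Suc_leI)
    finally show False using c True by (simp add: sum_UNIV_Plus)
  qed
  then have "{c :: 'a + 'b \<Rightarrow> nat. sum c UNIV = k \<and> (\<forall>j. c (Inl j) > 0)} = {}"
    by blast
  then show ?thesis using True by (simp only: card.empty if_True)
next
  case False
  define e :: "'a + 'b \<Rightarrow> nat" where "e = case_sum (\<lambda>_. 1) (\<lambda>_. 0)"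
  have e: "sum e UNIV = CARD('a)" by (simp add: e_def sum_UNIV_Plus)
  have "bij_betw (\<lambda>c r. c r + e r) {c :: 'a + 'b \<Rightarrow> nat. sum c UNIV = k - CARD('a)}
          {c. sum c UNIV = k \<and> (\<forall>j. c (Inl j) > 0)}"
  proof (rule bij_betw_byWitness[where f' = "\<lambda>c r. c r - e r"])
    have le: "e r \<le> c r" if "\<forall>j. c (Inl j) > 0" for c r
      using that by (cases r) (auto simp: e_def Suc_leI)
    show "\<forall>c\<in>{c. sum c UNIV = k \<and> (\<forall>j. c (Inl j) > 0)}. (\<lambda>r. c r - e r + e r) = c"
      using le by auto
    show "(\<lambda>c r. c r + e r) ` {c. sum c UNIV = k - CARD('a)}
            \<subseteq> {c. sum c UNIV = k \<and> (\<forall>j. c (Inl j) > 0)}"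
      using False e by (auto simp: sum.distrib e_def)
    have "(\<Sum>r\<in>UNIV. c r - e r) = sum c UNIV - sum e UNIV" if "\<forall>j. c (Inl j) > 0" for c
      using le[OF that] by (intro sum_subtractf_nat) auto
    then show "(\<lambda>c r. c r - e r) ` {c. sum c UNIV = k \<and> (\<forall>j. c (Inl j) > 0)}
            \<subseteq> {c. sum c UNIV = k - CARD('a)}"
      using e by auto
  qed auto
  then show ?thesis
    using False by (simp add: bij_betw_same_card)
qed

section \<open>Dilates of the convex hull of a finite family\<close>

text \<open>Indexing the coefficients by \<open>r\<close> rather than by the points \<open>f r\<close> keeps injectivity of \<open>f\<close>
  out of the description.\<close>

lemma convex_hull_range_finite:
  fixes f :: "'r::finite \<Rightarrow> 'v::real_vector"
  shows "convex hull (range f) = {\<Sum>r\<in>UNIV. c r *\<^sub>R f r | c. (\<forall>r. 0 \<le> c r) \<and> sum c UNIV = 1}"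
    (is "_ = ?C")
proof
  show "convex hull (range f) \<subseteq> ?C"
  proof (rule hull_minimal)
    show "range f \<subseteq> ?C"
    proof clarify
      fix r
      have "f r = (\<Sum>s\<in>UNIV. (if s = r then 1 else 0) *\<^sub>R f s)"
        by (simp add: if_distrib[of "\<lambda>x. x *\<^sub>R _"] cong: if_cong)
      then show "\<exists>c. f r = (\<Sum>r\<in>UNIV. c r *\<^sub>R f r) \<and> (\<forall>r. 0 \<le> c r) \<and> sum c UNIV = 1"
        by (intro exI[of _ "\<lambda>s. if s = r then 1 else 0"]) auto
    qed
    show "convex ?C"
    proof (rule convexI, clarify)
      fix u v :: real and c d :: "'r \<Rightarrow> real"
      assume *: "0 \<le> u" "0 \<le> v" "u + v = 1" "\<forall>r. 0 \<le> c r" "sum c UNIV = 1"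
        "\<forall>r. 0 \<le> d r" "sum d UNIV = 1"
      show "\<exists>e. u *\<^sub>R (\<Sum>r\<in>UNIV. c r *\<^sub>R f r) + v *\<^sub>R (\<Sum>r\<in>UNIV. d r *\<^sub>R f r)
                = (\<Sum>r\<in>UNIV. e r *\<^sub>R f r) \<and> (\<forall>r. 0 \<le> e r) \<and> sum e UNIV = 1"
        using * by (intro exI[of _ "\<lambda>r. u * c r + v * d r"])
          (simp add: scaleR_sum_right scaleR_left_distrib sum.distrib flip: sum_distrib_left)
    qed
  qed
  show "?C \<subseteq> convex hull (range f)"
    by (auto intro!: convex_sum intro: hull_inc)
qed

lemma scaled_convex_hull_range_finite:
  fixes f :: "'r::finite \<Rightarrow> 'v::real_vector"
  assumes "k \<ge> 0"
  shows "(\<lambda>v. k *\<^sub>R v) ` (convex hull (range f))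
           = {\<Sum>r\<in>UNIV. c r *\<^sub>R f r | c. (\<forall>r. 0 \<le> c r) \<and> sum c UNIV = k}"
    (is "?L = ?R")
proof
  show "?L \<subseteq> ?R"
  proof clarify
    fix v assume "v \<in> convex hull (range f)"
    then obtain c where c: "v = (\<Sum>r\<in>UNIV. c r *\<^sub>R f r)" "\<forall>r. 0 \<le> c r" "sum c UNIV = 1"
      by (auto simp: convex_hull_range_finite)
    have "k *\<^sub>R v = (\<Sum>r\<in>UNIV. (k * c r) *\<^sub>R f r)"
      by (simp add: c(1) scaleR_sum_right)
    moreover have "(\<Sum>r\<in>UNIV. k * c r) = k"
      using c(3) by (metis mult_1_right sum_distrib_left)
    ultimately show "\<exists>c. k *\<^sub>R v = (\<Sum>r\<in>UNIV. c r *\<^sub>R f r) \<and> (\<forall>r. 0 \<le> c r) \<and> sum c UNIV = k"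
      using assms c(2) by (intro exI[of _ "\<lambda>r. k * c r"]) simp
  qed
  show "?R \<subseteq> ?L"
  proof clarify
    fix c :: "'r \<Rightarrow> real" assume c: "\<forall>r. 0 \<le> c r" "k = sum c UNIV"
    show "(\<Sum>r\<in>UNIV. c r *\<^sub>R f r) \<in> (\<lambda>v. sum c UNIV *\<^sub>R v) ` (convex hull (range f))"
    proof (cases "sum c UNIV = 0")
      \<comment> \<open>Nothing can be rescaled here, but all coefficients vanish and the dilate by \<open>0\<close> of a
        nonempty set is the origin.\<close>
      case True
      then have "c r = 0" for r
        using c(1) by (simp add: sum_nonneg_eq_0_iff)
      moreover have "f undefined \<in> convex hull (range f)"
        by (simp add: hull_inc)
      ultimately show ?thesis
        using True by (auto intro!: image_eqI[of _ _ "f undefined"])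
    next
      case False
      define d where "d r = c r / sum c UNIV" for r
      have "0 \<le> d r" for r using c(1) by (simp add: d_def sum_nonneg)
      moreover have "sum d UNIV = 1"
        using False by (simp add: d_def flip: sum_divide_distrib)
      ultimately have "(\<Sum>r\<in>UNIV. d r *\<^sub>R f r) \<in> convex hull (range f)"
        by (auto simp: convex_hull_range_finite)
      then show ?thesis
        using False by (intro image_eqI[of _ _ "\<Sum>r\<in>UNIV. d r *\<^sub>R f r"])
          (auto simp: scaleR_sum_right d_def)
    qed
  qed
qed

section \<open>The rows of the block matrix\<close>

lemma ex1_idx_cong:
  assumes "bij_betw idx (UNIV :: 'n::finite set) {0..<CARD('n)}"
  shows "\<exists>!l. [idx l = m] (mod CARD('n))"
proof -
  have "idx l < CARD('n)" for l
    using bij_betwE[OF assms] by auto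
  then have "[idx l = m] (mod CARD('n)) \<longleftrightarrow> idx l = m mod CARD('n)" for l
    by (simp add: cong_def)
  moreover have "\<exists>!l. idx l = m mod CARD('n)"
    using assms unfolding bij_betw_iff_bijections
    by (metis UNIV_I atLeastLessThan_iff le0 mod_less_divisor zero_less_card_finite)
  ultimately show ?thesis by simp
qed

text \<open>Solve the congruence for \<open>idx l\<close>; over the natural numbers \<open>- m\<close> is represented by
  \<open>CARD('n) - m mod CARD('n)\<close>.\<close>

lemma ex1_idx_cong_add:
  assumes "bij_betw idx (UNIV :: 'n::finite set) {0..<CARD('n)}"
  shows "\<exists>!l. [idx j = idx l + m] (mod CARD('n))"
proof -
  have "[idx j = x + m] (mod CARD('n)) \<longleftrightarrow> [x = idx j + (CARD('n) - m mod CARD('n))] (mod CARD('n))" for x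
  proof -
    have "[m + (CARD('n) - m mod CARD('n)) = m mod CARD('n) + (CARD('n) - m mod CARD('n))] (mod CARD('n))"
      by (intro cong_add) auto
    then have 1: "[m + (CARD('n) - m mod CARD('n)) = 0] (mod CARD('n))"
      by (simp add: cong_def)
    have "[idx j = x + m] (mod CARD('n)) \<longleftrightarrow>
       [idx j + (CARD('n) - m mod CARD('n)) = x + (m + (CARD('n) - m mod CARD('n)))] (mod CARD('n))"
      by (metis add.assoc cong_add_rcancel_nat)
    also have "\<dots> \<longleftrightarrow> [idx j + (CARD('n) - m mod CARD('n)) = x] (mod CARD('n))"
      using cong_add[OF cong_refl 1, of x] by (metis add.right_neutral cong_sym cong_trans)
    finally show ?thesis by (metis cong_sym)
  qed
  then show ?thesis using ex1_idx_cong[OF assms] by simp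
qed

lemma matrix_power_cyclic_shift_nth:
  fixes idx :: "'n::finite \<Rightarrow> nat"
  assumes bij: "bij_betw idx UNIV {0..<CARD('n)}"
  shows "matrix_power (cyclic_shift idx) m $ i $ j
           = (if [idx j = idx i + m] (mod CARD('n)) then 1 else 0)"
proof (induction m arbitrary: i)
  case 0
  have "[idx j = idx i] (mod CARD('n)) \<longleftrightarrow> i = j"
    using ex1_idx_cong[OF bij, of "idx i"] by (metis cong_refl)
  then show ?case by (simp add: matrix_power_def mat_def)
next
  case (Suc m)
  obtain p where p: "[idx q = idx i + 1] (mod CARD('n)) \<longleftrightarrow> q = p" for q
    using ex1_idx_cong[OF bij, of "idx i + 1"] by metis
  have "matrix_power (cyclic_shift idx) (Suc m)
          = cyclic_shift idx ** matrix_power (cyclic_shift idx) m"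
    by (simp add: matrix_power_def)
  then have "matrix_power (cyclic_shift idx) (Suc m) $ i $ j
          = (\<Sum>q\<in>UNIV. (if q = p then 1 else 0) * (if [idx j = idx q + m] (mod CARD('n)) then 1 else 0))"
    using p by (simp add: matrix_matrix_mult_def Suc.IH) (simp add: cyclic_shift_def)
  also have "\<dots> = (if [idx j = idx p + m] (mod CARD('n)) then 1 else 0)"
    by (subst sum.remove[of _ p]) auto
  also have "[idx j = idx p + m] (mod CARD('n)) \<longleftrightarrow> [idx j = idx i + Suc m] (mod CARD('n))"
  proof -
    have "[idx p + m = (idx i + 1) + m] (mod CARD('n))"
      using p by (intro cong_add) auto
    then show ?thesis by (auto intro: cong_trans cong_sym)
  qed
  finally show ?case .
qed

definition row_comb :: "('n::finite \<Rightarrow> nat) \<Rightarrow> ('n + 'n \<Rightarrow> real) \<Rightarrow> real ^ ('n \<times> 'n)" where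
  "row_comb idx c = (\<Sum>r\<in>UNIV. c r *\<^sub>R row r (Q_matrix idx))"

context
  fixes idx :: "'n::finite \<Rightarrow> nat"
  assumes bij: "bij_betw idx (UNIV :: 'n set) {0..<CARD('n)}"
begin

text \<open>Column \<open>(k, j)\<close> of the block matrix has its two nonzero entries in the rows \<open>Inl j\<close> and
  \<open>Inr l\<close>.\<close>

lemma row_comb_nth:
  assumes l: "[idx j = idx l + idx k] (mod CARD('n))"
  shows "row_comb idx c $ (k, j) = c (Inl j) + c (Inr l)"
proof -
  have "[idx j = idx i + idx k] (mod CARD('n)) \<longleftrightarrow> i = l" for i
    using ex1_idx_cong_add[OF bij, of j "idx k"] l by blast
  then show ?thesis
    by (simp add: row_comb_def sum_UNIV_Plus row_def Q_matrix_def mat_def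
        matrix_power_cyclic_shift_nth[OF bij] if_distrib[of "\<lambda>x. _ * x"] cong: if_cong)
qed

lemma ex_row: "\<exists>l. [idx j = idx l + idx k] (mod CARD('n))"
  using ex1_idx_cong_add[OF bij] by blast

lemma ex_block: "\<exists>k. [idx j = idx l + idx k] (mod CARD('n))"
  using ex1_idx_cong_add[OF bij, of j "idx l"] by (metis add.commute)

text \<open>Every pair \<open>(j, l)\<close> is met by some column and every column meets some pair, so the
  coordinates can be forgotten in favour of the sums \<open>c (Inl j) + c (Inr l)\<close>.\<close>

lemma row_comb_eq_iff:
  "row_comb idx c = row_comb idx d \<longleftrightarrow>
     (\<forall>j l. c (Inl j) + c (Inr l) = d (Inl j) + d (Inr l))"
proof
  assume eq: "row_comb idx c = row_comb idx d"
  show "\<forall>j l. c (Inl j) + c (Inr l) = d (Inl j) + d (Inr l)"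
  proof (intro allI)
    fix j l
    obtain k where "[idx j = idx l + idx k] (mod CARD('n))"
      using ex_block by blast
    then show "c (Inl j) + c (Inr l) = d (Inl j) + d (Inr l)"
      using eq by (metis row_comb_nth)
  qed
next
  assume *: "\<forall>j l. c (Inl j) + c (Inr l) = d (Inl j) + d (Inr l)"
  show "row_comb idx c = row_comb idx d"
    unfolding vec_eq_iff using * ex_row row_comb_nth by (metis surj_pair)
qed

lemma row_comb_integral_iff:
  "(\<forall>p. row_comb idx c $ p \<in> \<int>) \<longleftrightarrow> (\<forall>j l. c (Inl j) + c (Inr l) \<in> \<int>)"
  using ex_row ex_block row_comb_nth by (metis surj_pair)

text \<open>Real coefficients of an integral point can be replaced by natural numbers: the common
  fractional part of the coefficients \<open>c (Inl j)\<close> is moved to the coefficients \<open>c (Inr l)\<close>. Since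
  there are equally many of both kinds, the total is preserved.\<close>

lemma lattice_points_scaled_Q:
  "{x \<in> (\<lambda>v. real k *\<^sub>R v) ` Q_polytope idx. \<forall>p. x $ p \<in> \<int>}
     = (\<lambda>c. row_comb idx (\<lambda>r. real (c r))) ` {c. sum c UNIV = k}" (is "?L = ?R")
proof -
  have rows: "rows (Q_matrix idx) = range (\<lambda>r. row r (Q_matrix idx))"
    by (auto simp: rows_def)
  have L: "?L = {row_comb idx c | c. (\<forall>r. 0 \<le> c r) \<and> sum c UNIV = real k
                   \<and> (\<forall>j l. c (Inl j) + c (Inr l) \<in> \<int>)}"
    unfolding row_comb_integral_iff[symmetric]
    by (auto simp: Q_polytope_def rows scaled_convex_hull_range_finite row_comb_def)
  show ?thesis unfolding L
  proof (intro equalityI subsetI; clarify)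
    fix c :: "'n + 'n \<Rightarrow> real"
    assume c: "\<forall>r. 0 \<le> c r" "sum c UNIV = real k" "\<forall>j l. c (Inl j) + c (Inr l) \<in> \<int>"
    \<comment> \<open>If \<open>x + y\<close> is an integer, then rounding \<open>x\<close> down and \<open>y\<close> up does not change the sum.\<close>
    define d :: "'n + 'n \<Rightarrow> nat" where
      "d = case_sum (\<lambda>j. nat \<lfloor>c (Inl j)\<rfloor>) (\<lambda>l. nat \<lceil>c (Inr l)\<rceil>)"
    have pair: "real (d (Inl j)) + real (d (Inr l)) = c (Inl j) + c (Inr l)" for j l
    proof -
      obtain m where m: "c (Inl j) + c (Inr l) = of_int m"
        using c(3) Ints_cases by blast
      then have "c (Inr l) = of_int m - c (Inl j)" by simp
      then have "\<lceil>c (Inr l)\<rceil> = m - \<lfloor>c (Inl j)\<rfloor>"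
        by (simp add: ceiling_def)
      moreover have "0 \<le> \<lfloor>c (Inl j)\<rfloor>" "0 \<le> \<lceil>c (Inr l)\<rceil>"
        using c(1) by (simp_all add: less_le_trans[of "-1" 0])
      ultimately show ?thesis using m by (simp add: d_def)
    qed
    have "real (sum d UNIV) = (\<Sum>i\<in>UNIV. real (d (Inl i)) + real (d (Inr i)))"
      by (simp add: sum_UNIV_Plus sum.distrib)
    also have "\<dots> = real k"
      using c(2) by (simp add: pair sum_UNIV_Plus sum.distrib)
    finally have "sum d UNIV = k" by linarith
    moreover have "row_comb idx c = row_comb idx (\<lambda>r. real (d r))"
      by (simp add: row_comb_eq_iff pair)
    ultimately show "row_comb idx c \<in> ?R" by blast
  next
    fix c :: "'n + 'n \<Rightarrow> nat"
    show "\<exists>d. row_comb idx (\<lambda>r. real (c r)) = row_comb idx d \<and> (\<forall>r. 0 \<le> d r)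
            \<and> sum d UNIV = real (sum c UNIV) \<and> (\<forall>j l. d (Inl j) + d (Inr l) \<in> \<int>)"
      by (intro exI[of _ "\<lambda>r. real (c r)"]) simp
  qed
qed

text \<open>The relation between the rows allows the smallest \<open>c (Inl j)\<close> to be moved to the
  \<open>c (Inr l)\<close>. Afterwards no freedom is left: a further shift would make some \<open>c (Inl j)\<close>
  negative or all of them positive.\<close>

lemma normalise_coefficients:
  "(\<lambda>c. row_comb idx (\<lambda>r. real (c r))) ` {c. sum c UNIV = k}
     = (\<lambda>c. row_comb idx (\<lambda>r. real (c r))) ` {c. sum c UNIV = k \<and> (\<exists>j. c (Inl j) = 0)}"
proof (intro equalityI subsetI; clarify)
  fix c :: "'n + 'n \<Rightarrow> nat"
  define m where "m = Min (range (\<lambda>j. c (Inl j)))"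
  have m_le: "m \<le> c (Inl j)" for j by (simp add: m_def)
  have "m \<in> range (\<lambda>j. c (Inl j))" unfolding m_def by (intro Min_in) auto
  then obtain j0 where j0: "c (Inl j0) = m" by auto
  define d :: "'n + 'n \<Rightarrow> nat" where "d = case_sum (\<lambda>j. c (Inl j) - m) (\<lambda>l. c (Inr l) + m)"
  have pair: "d (Inl j) + d (Inr l) = c (Inl j) + c (Inr l)" for j l
    using m_le[of j] by (simp add: d_def)
  have "sum d UNIV = (\<Sum>i\<in>UNIV. d (Inl i) + d (Inr i))"
    by (simp add: sum_UNIV_Plus sum.distrib)
  also have "\<dots> = sum c UNIV"
    by (simp add: pair sum_UNIV_Plus sum.distrib)
  finally have "sum d UNIV = sum c UNIV" .
  moreover have "d (Inl j0) = 0" using j0 by (simp add: d_def)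
  moreover have "row_comb idx (\<lambda>r. real (c r)) = row_comb idx (\<lambda>r. real (d r))"
    unfolding row_comb_eq_iff using pair by (metis of_nat_add)
  ultimately show "row_comb idx (\<lambda>r. real (c r)) \<in> (\<lambda>c. row_comb idx (\<lambda>r. real (c r))) `
      {d. sum d UNIV = sum c UNIV \<and> (\<exists>j. d (Inl j) = 0)}" by blast
qed auto

lemma inj_on_normalised_coefficients:
  "inj_on (\<lambda>c. row_comb idx (\<lambda>r. real (c r))) {c :: 'n + 'n \<Rightarrow> nat. \<exists>j. c (Inl j) = 0}"
proof (rule inj_onI, clarify)
  fix c d :: "'n + 'n \<Rightarrow> nat" and i j
  assume "row_comb idx (\<lambda>r. real (c r)) = row_comb idx (\<lambda>r. real (d r))"
  then have eq: "c (Inl p) + c (Inr l) = d (Inl p) + d (Inr l)" for p l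
    unfolding row_comb_eq_iff by (metis of_nat_add of_nat_eq_iff)
  assume "c (Inl i) = 0" "d (Inl j) = 0"
  then have Inr: "c (Inr l) = d (Inr l)" for l
    using eq[of i l] eq[of j l] by simp
  then have "c (Inl p) = d (Inl p)" for p
    using eq[of p p] by simp
  with Inr show "c = d" by (intro ext) (metis sum.exhaust)
qed

text \<open>The normalised coefficient vectors are the weak compositions outside the set counted by
  \<open>card_weak_compositions_Inl_positive\<close>. The equation is stated additively to avoid truncated
  subtraction.\<close>

lemma ehrhart_Q:
  "ehrhart (Q_polytope idx) k + (if k < CARD('n) then 0
        else card {c :: 'n + 'n \<Rightarrow> nat. sum c UNIV = k - CARD('n)})
     = card {c :: 'n + 'n \<Rightarrow> nat. sum c UNIV = k}"
proof -
  let ?A = "{c :: 'n + 'n \<Rightarrow> nat. sum c UNIV = k}"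
  let ?N = "{c :: 'n + 'n \<Rightarrow> nat. sum c UNIV = k \<and> (\<exists>j. c (Inl j) = 0)}"
  let ?P = "{c :: 'n + 'n \<Rightarrow> nat. sum c UNIV = k \<and> (\<forall>j. c (Inl j) > 0)}"
  have "ehrhart (Q_polytope idx) k = card ?N"
    unfolding ehrhart_def lattice_points_scaled_Q normalise_coefficients
    by (intro card_image inj_on_subset[OF inj_on_normalised_coefficients]) auto
  moreover have "card ?A = card ?N + card ?P"
  proof -
    have compl: "(\<exists>j. c (Inl j) = 0) \<longleftrightarrow> \<not> (\<forall>j. c (Inl j) > 0)" for c :: "'n + 'n \<Rightarrow> nat"
      by simp
    have "?A = ?N \<union> ?P"
      unfolding compl by (rule set_eqI) (simp only: Un_iff mem_Collect_eq, argo)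
    moreover have "?N \<inter> ?P = {}"
      unfolding compl by (rule equals0I) (simp only: Int_iff mem_Collect_eq, argo)
    moreover have "finite ?N" "finite ?P"
      by (rule finite_subset[OF _ finite_weak_compositions[of k]], blast)+
    ultimately show ?thesis
      by (simp only: card_Un_disjoint)
  qed
  ultimately show ?thesis
    by (simp only: card_weak_compositions_Inl_positive)
qed

lemma fps_ehrhart_Q:
  "Abs_fps (\<lambda>k. of_nat (ehrhart (Q_polytope idx) k)) * (1 - fps_X) ^ (2 * CARD('n))
     = (1 - fps_X ^ CARD('n) :: 'a::field fps)"
proof -
  define N :: "'a fps"
    where "N = Abs_fps (\<lambda>k. of_nat (card {c :: 'n + 'n \<Rightarrow> nat. sum c UNIV = k}))"
  have "Abs_fps (\<lambda>k. of_nat (ehrhart (Q_polytope idx) k)) = N - fps_X ^ CARD('n) * N"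
  proof (rule fps_ext)
    fix k
    show "fps_nth (Abs_fps (\<lambda>k. of_nat (ehrhart (Q_polytope idx) k))) k
            = fps_nth (N - fps_X ^ CARD('n) * N) k"
      using arg_cong[OF ehrhart_Q[of k], of "of_nat :: nat \<Rightarrow> 'a"]
      by (auto simp: N_def fps_X_power_mult_nth algebra_simps split: if_splits)
  qed
  also have "\<dots> = (1 - fps_X ^ CARD('n)) * N"
    by (simp add: algebra_simps)
  finally show ?thesis
    using fps_weak_compositions[where 'a = "'n + 'n" and 'b = 'a]
    by (simp add: N_def card_UNIV_sum mult_2 mult.assoc)
qed

section \<open>Dimension\<close>

lemma row_comb_indicator: "row_comb idx (\<lambda>s. if s = r then 1 else 0) = row r (Q_matrix idx)"
  by (simp add: row_comb_def if_distrib[of "\<lambda>x. x *\<^sub>R _"] cong: if_cong)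

text \<open>For \<open>CARD('n) = 1\<close> this fails, as both rows are then equal.\<close>

lemma inj_row_Q:
  assumes "CARD('n) \<ge> 2"
  shows "inj (\<lambda>r. row r (Q_matrix idx))"
proof (rule injI)
  fix r s assume eq: "row r (Q_matrix idx) = row s (Q_matrix idx)"
  have ne: "\<exists>q. q \<noteq> p" for p :: 'n
  proof (rule ccontr)
    assume "\<nexists>q. q \<noteq> p"
    then have "UNIV = {p}" by blast
    then have "CARD('n) = 1" by (auto simp: card_1_singleton_iff)
    with assms show False by simp
  qed
  from eq have "row_comb idx (\<lambda>t. if t = r then 1 else 0) = row_comb idx (\<lambda>t. if t = s then 1 else 0)"
    by (simp add: row_comb_indicator)
  then have *: "(if Inl j = r then 1 else 0) + (if Inr l = r then 1 else 0) =
       (if Inl j = s then 1 else (0::real)) + (if Inr l = s then 1 else 0)" for j l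
    unfolding row_comb_eq_iff by blast
  show "r = s"
  proof (cases r)
    case r: (Inl i)
    show ?thesis
    proof (cases s)
      case s: (Inl i')
      show ?thesis using *[of i undefined] r s by (simp split: if_splits)
    next
      case s: (Inr l)
      obtain j where "j \<noteq> i" using ne by blast
      then show ?thesis using *[of j l] r s by simp
    qed
  next
    case r: (Inr i)
    show ?thesis
    proof (cases s)
      case s: (Inl i')
      obtain j where "j \<noteq> i'" using ne by blast
      then show ?thesis using *[of j i] r s by simp
    next
      case s: (Inr l)
      show ?thesis using *[of undefined i] r s by (simp split: if_splits)
    qed
  qed
qed

text \<open>The relation \<open>\<Sum>u\<^sub>j = \<Sum>v\<^sub>l\<close> expresses one of the rows \<open>v\<^sub>p\<close> as an affine combination of the
  other \<open>2n - 1\<close> rows, and these are affinely independent since every relation is a multiple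
  of this one.\<close>

lemma aff_dim_Q:
  assumes n: "CARD('n) \<ge> 2"
  shows "aff_dim (Q_polytope idx) = 2 * int CARD('n) - 2"
proof -
  let ?f = "\<lambda>r. row r (Q_matrix idx)"
  \<comment> \<open>The relation between the rows involves all of them, so dropping an arbitrary one
    leaves a linearly independent family.\<close>
  define p :: 'n where "p = undefined"
  define U :: "('n + 'n) set" where "U = UNIV - {Inr p}"
  have inj: "inj ?f" by (rule inj_row_Q[OF n])
  have comb: "(\<Sum>r\<in>U. c r *\<^sub>R ?f r) = row_comb idx c" if "c (Inr p) = 0" for c
    unfolding row_comb_def U_def using that by (intro sum.mono_neutral_left) auto
  have indep: "\<not> affine_dependent (?f ` U)"
  proof
    assume "affine_dependent (?f ` U)"
    then obtain g v where g: "v \<in> ?f ` U" "g v \<noteq> 0" "(\<Sum>w\<in>?f ` U. g w *\<^sub>R w) = 0"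
      by (auto simp: affine_dependent_explicit_finite)
    define c where "c r = (if r = Inr p then 0 else g (?f r))" for r
    have "row_comb idx c = (\<Sum>r\<in>U. c r *\<^sub>R ?f r)"
      by (rule comb[symmetric]) (simp add: c_def)
    also have "\<dots> = (\<Sum>r\<in>U. g (?f r) *\<^sub>R ?f r)"
      by (intro sum.cong) (auto simp: c_def U_def)
    also have "\<dots> = (\<Sum>w\<in>?f ` U. g w *\<^sub>R w)"
      by (subst sum.reindex) (auto intro: inj_on_subset[OF inj])
    also have "\<dots> = row_comb idx (\<lambda>_. 0)"
      using g(3) by (simp add: row_comb_def)
    finally have sum0: "c (Inl j) + c (Inr l) = 0" for j l
      unfolding row_comb_eq_iff by simp
    have Inl: "c (Inl j) = 0" for j
      using sum0[of j p] by (simp add: c_def)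
    then have "c (Inr l) = 0" for l
      using sum0[of l l] by simp
    with Inl have "c r = 0" for r by (cases r) auto
    then show False using g(1,2) by (force simp: c_def U_def split: if_splits)
  qed
  have "?f (Inr p) \<in> affine hull (?f ` U)"
  proof -
    define c :: "'n + 'n \<Rightarrow> real"
      where "c = case_sum (\<lambda>_. 1) (\<lambda>l. if l = p then 0 else - 1)"
    have "?f (Inr p) = row_comb idx c"
      unfolding row_comb_indicator[symmetric] row_comb_eq_iff by (simp add: c_def)
    also have "\<dots> = (\<Sum>r\<in>U. c r *\<^sub>R ?f r)"
      by (rule comb[symmetric]) (simp add: c_def)
    also have "\<dots> \<in> affine hull (?f ` U)"
    proof -
      have "sum c U = sum c UNIV"
        unfolding U_def by (intro sum.mono_neutral_left) (auto simp: c_def)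
      also have "\<dots> = real CARD('n) + (\<Sum>l\<in>UNIV. (if l = p then 1 else 0) - 1)"
        by (simp add: sum_UNIV_Plus c_def) (intro sum.cong, auto)
      also have "\<dots> = 1"
        by (simp add: sum_subtractf)
      finally have "sum c U = 1" .
      then show ?thesis
        unfolding affine_hull_finite[OF finite_imageI[OF finite]] using inj
        by (intro CollectI exI[of _ "c \<circ> inv ?f"])
          (simp add: sum.reindex[OF inj_on_subset[OF inj subset_UNIV]] inv_f_f[OF inj])
    qed
    finally show ?thesis .
  qed
  moreover have "rows (Q_matrix idx) = insert (?f (Inr p)) (?f ` U)"
    by (auto simp: rows_def U_def)
  ultimately have "aff_dim (Q_polytope idx) = aff_dim (?f ` U)"
    by (simp add: Q_polytope_def aff_dim_convex_hull aff_dim_insert)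
  also have "\<dots> = int (card (?f ` U)) - 1"
    using aff_dim_affine_independent[OF indep] by linarith
  also have "card (?f ` U) = card U"
    by (intro card_image inj_on_subset[OF inj]) auto
  also have "card U = 2 * CARD('n) - 1"
    by (simp add: U_def card_Diff_singleton card_UNIV_sum)
  finally show ?thesis using n by simp
qed

end

theorem theorem5p3:
  fixes n :: nat and idx :: "'n::finite \<Rightarrow> nat"
  assumes "n \<ge> 2"
    and "CARD('n) = n"
    and "bij_betw idx (UNIV :: 'n set) {0..<n}"
  shows "\<forall>i. coeff (hstar_poly (Q_polytope idx)) i = (if i \<le> n - 1 then 1 else 0)"
proof -
  define h :: "rat poly" where "h = (\<Sum>i<n. monom 1 i)"
  define F :: "rat fps" where "F = Abs_fps (\<lambda>k. of_nat (ehrhart (Q_polytope idx) k))"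
  have bij: "bij_betw idx (UNIV :: 'n set) {0..<CARD('n)}"
    using assms by simp
  have dim: "nat (aff_dim (Q_polytope idx)) + 1 = 2 * n - 1"
    using aff_dim_Q[OF bij] assms by simp
  have "(1 - fps_X) * fps_of_poly h = 1 - fps_X ^ n"
    by (simp add: h_def fps_of_poly_sum fps_of_poly_monom one_diff_power_eq)
  also have "\<dots> = F * (1 - fps_X) ^ (2 * n)"
    using fps_ehrhart_Q[OF bij, where 'a = rat] assms by (simp add: F_def)
  also have "\<dots> = (1 - fps_X) * (F * (1 - fps_X) ^ (2 * n - 1))"
    using assms(1) by (simp add: power_eq_if mult_ac)
  \<comment> \<open>Formal power series over a field form an integral domain, so one factor cancels.\<close>
  finally have "F * (1 - fps_X) ^ (2 * n - 1) = fps_of_poly h"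
    by (metis fps_X_neq_one mult_cancel_left right_minus_eq)
  then have "hstar_poly (Q_polytope idx) = h"
    by (intro hstar_poly_eqI) (simp only: dim F_def)
  then show ?thesis
    using assms(1) by (auto simp: h_def coeff_sum)
qed

end
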